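(* Linearly recurrent Cantor systems are not strongly mixing: if $(X,T)$ is a linearly recurrent Cantor system and $\mu$ is its unique $T$-invariant Borel probability measure, then $(X,T,\mu)$ is not strongly mixing.
   Context: A Cantor system $(X,T)$ is a Cantor space $X$ together with a homeomorphism $T:X\to X$; it is minimal if the only closed $T$-invariant subsets are $\emptyset$ and $X$. $\mathbb N=\{0,1,2,\dots\}$. A clopen Kakutani-Rokhlin (CKR) partition of $X$ is a partition of $X$ of the form $\{T^{-j}B_k : 1\le k\le C,\ 0\le j<h_k\}$, where $C\ge 1$, $B_1,\dots,B_C$ are (nonempty) clopen subsets of $X$ and $h_1,\dots,h_C$ are positive integers; its base is $B=\bigcup_k B_k$. Consider a sequence of CKR partitions $\mathcal P(n)=\{T^{-j}B_k(n):1\le k\le C(n),\ 0\le j<h_k(n)\}$, $n\in\mathbb N$, with bases $B(n)$, where $\mathcal P(0)$ is trivial: $B(0)=X$, $C(0)=1$, $h_1(0)=1$. The following properties are considered: (KR1) $B(n+1)\subset B(n)$ for all $n\ge 0$; (KR2) for all $n\ge 0$ every element of $\mathcal P(n+1)$ is contained in an element of $\mathcal P(n)$; (KR3) $\bigcap_{n} B(n)$ is a single point; (KR4) the sequence of partitions spans the topology of $X$; (KR5) for all $n\ge1$, $1\le k\le C(n-1)$, $1\le l\le C(n)$ there is $0\le j<h_l(n)$ with $T^{-j}B_l(n)\subset B_k(n-1)$; (KR6) $B(n+1)\subset B_1(n)$ for all $n\in\mathbb N$. The sequence is nested if (KR1) and (KR2) hold. A minimal Cantor system $(X,T)$ is linearly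 recurrent (with constant $L$) if there is such a sequence satisfying (KR1)-(KR6) and (LR) there is $L$ such that $h_l(n)\le L\,h_k(n-1)$ for all $n\ge1$, $1\le l\le C(n)$, $1\le k\le C(n-1)$. Linearly recurrent Cantor systems are uniquely ergodic. *)

theory Defs
  imports "HOL-Probability.Probability"
begin

definition cantor_space :: "'a topology \<Rightarrow> bool" where
  "cantor_space X \<longleftrightarrow>
     X homeomorphic_space product_topology (\<lambda>_::nat. discrete_topology (UNIV :: bool set)) UNIV"

definition cantor_system :: "'a topology \<Rightarrow> ('a \<Rightarrow> 'a) \<Rightarrow> bool" where
  "cantor_system X T \<longleftrightarrow> cantor_space X \<and> homeomorphic_map X X T"

definition minimal_cantor_system :: "'a topology \<Rightarrow> ('a \<Rightarrow> 'a) \<Rightarrow> bool" where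
  "minimal_cantor_system X T \<longleftrightarrow>
     cantor_system X T \<and>
     (\<forall>F. closedin X F \<and> T ` F = F \<longrightarrow> F = {} \<or> F = topspace X)"

text \<open>The set \<open>T\<^sup>-\<^sup>j A\<close>, as a subset of the carrier \<open>S\<close> on which \<open>T\<close> acts.\<close>

definition preimage_iter :: "'a set \<Rightarrow> ('a \<Rightarrow> 'a) \<Rightarrow> nat \<Rightarrow> 'a set \<Rightarrow> 'a set" where
  "preimage_iter S T j A = (T ^^ j) -` A \<inter> S"

text \<open>
  A clopen Kakutani-Rokhlin partition is given by the number \<open>c\<close> of its towers and, for
  \<open>k \<in> {1..c}\<close>, the height \<open>h k\<close> and the base \<open>B k\<close> of the \<open>k\<close>-th tower; the values of
  \<open>h\<close> and \<open>B\<close> outside \<open>{1..c}\<close> are irrelevant.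
\<close>

definition kr_index :: "nat \<Rightarrow> (nat \<Rightarrow> nat) \<Rightarrow> (nat \<times> nat) set" where
  "kr_index c h = (SIGMA k:{1..c}. {..<h k})"

definition kr_atoms ::
  "'a topology \<Rightarrow> ('a \<Rightarrow> 'a) \<Rightarrow> nat \<Rightarrow> (nat \<Rightarrow> nat) \<Rightarrow> (nat \<Rightarrow> 'a set) \<Rightarrow> 'a set set" where
  "kr_atoms X T c h B = (\<lambda>(k, j). preimage_iter (topspace X) T j (B k)) ` kr_index c h"

definition kr_base :: "nat \<Rightarrow> (nat \<Rightarrow> 'a set) \<Rightarrow> 'a set" where
  "kr_base c B = (\<Union>k\<in>{1..c}. B k)"

text \<open>
  Disjointness is required of the indexed family: atoms with different indices \<open>(k, j)\<close>
  are disjoint, not merely equal or disjoint.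
\<close>

definition ckr_partition ::
  "'a topology \<Rightarrow> ('a \<Rightarrow> 'a) \<Rightarrow> nat \<Rightarrow> (nat \<Rightarrow> nat) \<Rightarrow> (nat \<Rightarrow> 'a set) \<Rightarrow> bool" where
  "ckr_partition X T c h B \<longleftrightarrow>
     1 \<le> c \<and>
     (\<forall>k\<in>{1..c}. openin X (B k) \<and> closedin X (B k) \<and> B k \<noteq> {} \<and> 0 < h k) \<and>
     disjoint_family_on (\<lambda>(k, j). preimage_iter (topspace X) T j (B k)) (kr_index c h) \<and>
     \<Union>(kr_atoms X T c h B) = topspace X"

definition ckr_sequence ::
  "'a topology \<Rightarrow> ('a \<Rightarrow> 'a) \<Rightarrow> (nat \<Rightarrow> nat) \<Rightarrow> (nat \<Rightarrow> nat \<Rightarrow> nat) \<Rightarrow> (nat \<Rightarrow> nat \<Rightarrow> 'a set) \<Rightarrow> bool" where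
  "ckr_sequence X T C h B \<longleftrightarrow>
     (\<forall>n. ckr_partition X T (C n) (h n) (B n)) \<and>
     C 0 = 1 \<and> h 0 1 = 1 \<and> kr_base (C 0) (B 0) = topspace X"

definition KR1 :: "(nat \<Rightarrow> nat) \<Rightarrow> (nat \<Rightarrow> nat \<Rightarrow> 'a set) \<Rightarrow> bool" where
  "KR1 C B \<longleftrightarrow> (\<forall>n. kr_base (C (Suc n)) (B (Suc n)) \<subseteq> kr_base (C n) (B n))"

definition KR2 ::
  "'a topology \<Rightarrow> ('a \<Rightarrow> 'a) \<Rightarrow> (nat \<Rightarrow> nat) \<Rightarrow> (nat \<Rightarrow> nat \<Rightarrow> nat) \<Rightarrow> (nat \<Rightarrow> nat \<Rightarrow> 'a set) \<Rightarrow> bool" where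
  "KR2 X T C h B \<longleftrightarrow>
     (\<forall>n. \<forall>P\<in>kr_atoms X T (C (Suc n)) (h (Suc n)) (B (Suc n)).
        \<exists>Q\<in>kr_atoms X T (C n) (h n) (B n). P \<subseteq> Q)"

definition KR3 :: "(nat \<Rightarrow> nat) \<Rightarrow> (nat \<Rightarrow> nat \<Rightarrow> 'a set) \<Rightarrow> bool" where
  "KR3 C B \<longleftrightarrow> is_singleton (\<Inter>n. kr_base (C n) (B n))"

definition KR4 ::
  "'a topology \<Rightarrow> ('a \<Rightarrow> 'a) \<Rightarrow> (nat \<Rightarrow> nat) \<Rightarrow> (nat \<Rightarrow> nat \<Rightarrow> nat) \<Rightarrow> (nat \<Rightarrow> nat \<Rightarrow> 'a set) \<Rightarrow> bool" where
  "KR4 X T C h B \<longleftrightarrow> topology_generated_by (\<Union>n. kr_atoms X T (C n) (h n) (B n)) = X"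

definition KR5 ::
  "'a topology \<Rightarrow> ('a \<Rightarrow> 'a) \<Rightarrow> (nat \<Rightarrow> nat) \<Rightarrow> (nat \<Rightarrow> nat \<Rightarrow> nat) \<Rightarrow> (nat \<Rightarrow> nat \<Rightarrow> 'a set) \<Rightarrow> bool" where
  "KR5 X T C h B \<longleftrightarrow>
     (\<forall>n\<ge>1. \<forall>k\<in>{1..C (n - 1)}. \<forall>l\<in>{1..C n}.
        \<exists>j<h n l. preimage_iter (topspace X) T j (B n l) \<subseteq> B (n - 1) k)"

definition KR6 :: "(nat \<Rightarrow> nat) \<Rightarrow> (nat \<Rightarrow> nat \<Rightarrow> 'a set) \<Rightarrow> bool" where
  "KR6 C B \<longleftrightarrow> (\<forall>n. kr_base (C (Suc n)) (B (Suc n)) \<subseteq> B n 1)"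

definition LR :: "real \<Rightarrow> (nat \<Rightarrow> nat) \<Rightarrow> (nat \<Rightarrow> nat \<Rightarrow> nat) \<Rightarrow> bool" where
  "LR L C h \<longleftrightarrow>
     (\<forall>n\<ge>1. \<forall>l\<in>{1..C n}. \<forall>k\<in>{1..C (n - 1)}. real (h n l) \<le> L * real (h (n - 1) k))"

definition linearly_recurrent :: "'a topology \<Rightarrow> ('a \<Rightarrow> 'a) \<Rightarrow> bool" where
  "linearly_recurrent X T \<longleftrightarrow>
     minimal_cantor_system X T \<and>
     (\<exists>C h B. ckr_sequence X T C h B \<and>
        KR1 C B \<and> KR2 X T C h B \<and> KR3 C B \<and> KR4 X T C h B \<and> KR5 X T C h B \<and> KR6 C B \<and>
        (\<exists>L. LR L C h))"

definition invariant_borel_prob :: "'a topology \<Rightarrow> ('a \<Rightarrow> 'a) \<Rightarrow> 'a measure \<Rightarrow> bool" where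
  "invariant_borel_prob X T M \<longleftrightarrow>
     prob_space M \<and>
     space M = topspace X \<and>
     sets M = sigma_sets (topspace X) {U. openin X U} \<and>
     (\<forall>A\<in>sets M. emeasure M (preimage_iter (space M) T 1 A) = emeasure M A)"

definition strongly_mixing :: "'a measure \<Rightarrow> ('a \<Rightarrow> 'a) \<Rightarrow> bool" where
  "strongly_mixing M T \<longleftrightarrow>
     (\<forall>A\<in>sets M. \<forall>B\<in>sets M.
        (\<lambda>n. measure M (A \<inter> preimage_iter (space M) T n B)) \<longlonglongrightarrow> measure M A * measure M B)"

end

theory Submission
  imports Defs
begin

text \<open>
  The system is partially rigid. Since \<open>B(n+1) \<subseteq> B\<^sub>1(n)\<close>, a point of the \<open>j\<close>-th floor over
  \<open>B\<^sub>l(n+1)\<close> with \<open>j < h\<^sub>1(n)\<close> and its image under \<open>T\<close> to the power \<open>-t\<close>, where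
  \<open>t = h\<^sub>l(n+1)\<close>, lie in the same atom of \<open>\<P>(n)\<close>, hence of every \<open>\<P>(m)\<close> with \<open>m \<le> n\<close>. Each
  tower of level \<open>n + 1\<close> crosses all towers of level \<open>n\<close>, so linear recurrence gives
  \<open>C(n) \<le> L\<close>; therefore some tower of level \<open>n + 1\<close> has mass at least \<open>1/L\<close>, and
  its floors below height \<open>h\<^sub>1(n)\<close> have mass at least \<open>1/L\<^sup>2\<close>. Thus the sum of
  \<open>\<mu>(a \<inter> T\<^sup>-\<^sup>t a)\<close> over the atoms \<open>a\<close> of \<open>\<P>(m)\<close> is at least \<open>1/L\<^sup>2\<close> for arbitrarily large \<open>t\<close>.
  Under strong mixing it would tend to the sum of \<open>\<mu>(a)\<^sup>2\<close>, which is at most the largest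
  \<open>\<mu>(a)\<close> and so tends to \<open>0\<close> as \<open>m\<close> grows.
\<close>

section \<open>Iterates, preimages and the size of a Cantor space\<close>

lemma funpow_in:
  assumes "T ` S \<subseteq> S" "x \<in> S"
  shows "(T ^^ n) x \<in> S"
  using assms by (induction n) auto

lemma funpow_image_eq:
  assumes "T ` S = S"
  shows "(T ^^ n) ` S = S"
proof (induction n)
  case (Suc n)
  have "(T ^^ Suc n) ` S = T ` (T ^^ n) ` S" by (simp add: image_comp)
  then show ?case using Suc assms by simp
qed simp

lemma preimage_iter_mono: "A \<subseteq> B \<Longrightarrow> preimage_iter S T n A \<subseteq> preimage_iter S T n B"
  by (auto simp: preimage_iter_def)

lemma preimage_iter_preimage_iter:
  assumes "T ` S \<subseteq> S"
  shows "preimage_iter S T i (preimage_iter S T j A) = preimage_iter S T (j + i) A"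
  using funpow_in[OF assms] by (auto simp: preimage_iter_def funpow_add)

lemma cantor_space_infinite:
  assumes "cantor_space X"
  shows "infinite (topspace X)"
proof -
  let ?Y = "product_topology (\<lambda>_::nat. discrete_topology (UNIV :: bool set)) UNIV"
  have "topspace X \<approx> topspace ?Y"
    using assms homeomorphic_imp_injective_map homeomorphic_imp_surjective_map
    unfolding cantor_space_def homeomorphic_space eqpoll_def bij_betw_def by blast
  moreover have "topspace ?Y = (UNIV :: (nat \<Rightarrow> bool) set)"
    by auto
  moreover have "infinite (UNIV :: (nat \<Rightarrow> bool) set)"
  proof
    assume "finite (UNIV :: (nat \<Rightarrow> bool) set)"
    then have "finite (UNIV :: nat set)" by (rule finite_fun_UNIVD1) simp
    then show False by simp
  qed
  ultimately show ?thesis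
    by (metis eqpoll_finite_iff)
qed

section \<open>Towers of Kakutani-Rokhlin partitions\<close>

abbreviation kr_atom :: "'a set \<Rightarrow> ('a \<Rightarrow> 'a) \<Rightarrow> (nat \<Rightarrow> 'a set) \<Rightarrow> nat \<times> nat \<Rightarrow> 'a set" where
  "kr_atom S T B \<equiv> \<lambda>(k, j). preimage_iter S T j (B k)"

lemma finite_kr_index [simp]: "finite (kr_index c h)"
  by (simp add: kr_index_def)

lemma mem_kr_index [simp]: "(k, j) \<in> kr_index c h \<longleftrightarrow> k \<in> {1..c} \<and> j < h k"
  by (auto simp: kr_index_def)

lemma ckr_partition_base_subset:
  assumes "ckr_partition X T c h B" "k \<in> {1..c}"
  shows "B k \<subseteq> topspace X"
  using assms openin_subset unfolding ckr_partition_def by blast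

lemma ckr_partition_unique:
  assumes "ckr_partition X T c h B"
    and "k \<in> {1..c}" "j < h k" "k' \<in> {1..c}" "j' < h k'"
    and "x \<in> preimage_iter (topspace X) T j (B k)" "x \<in> preimage_iter (topspace X) T j' (B k')"
  shows "k = k' \<and> j = j'"
proof (rule ccontr)
  assume "\<not> (k = k' \<and> j = j')"
  then have "kr_atom (topspace X) T B (k, j) \<inter> kr_atom (topspace X) T B (k', j') = {}"
    using assms(1-5) unfolding ckr_partition_def disjoint_family_on_def
    by (metis mem_kr_index prod.inject)
  then show False using assms(6,7) by auto
qed

lemma ckr_partition_cover:
  assumes "ckr_partition X T c h B" "x \<in> topspace X"
  obtains k j where "k \<in> {1..c}" "j < h k" "x \<in> preimage_iter (topspace X) T j (B k)"
proof -
  have "x \<in> \<Union>(kr_atoms X T c h B)"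
    using assms by (simp add: ckr_partition_def)
  then show ?thesis using that by (auto simp: kr_atoms_def)
qed

text \<open>If a point of this preimage sat on a floor \<open>j > 0\<close> of tower
  \<open>k\<close>, its image under \<open>T\<close> would have both addresses
  \<open>(k, j - 1)\<close> and \<open>(l, h l - 1)\<close>. Then \<open>k = l\<close> and
  \<open>j = h l\<close>, which is above the top floor.\<close>

lemma ckr_partition_return:
  assumes part: "ckr_partition X T c h B" and T: "T ` topspace X \<subseteq> topspace X"
    and l: "l \<in> {1..c}"
  shows "preimage_iter (topspace X) T (h l) (B l) \<subseteq> kr_base c B"
proof
  fix x assume x: "x \<in> preimage_iter (topspace X) T (h l) (B l)"
  then have xS: "x \<in> topspace X" by (simp add: preimage_iter_def)
  obtain k j where kj: "k \<in> {1..c}" "j < h k" "x \<in> preimage_iter (topspace X) T j (B k)"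
    using ckr_partition_cover[OF part xS] .
  have "h l > 0" using part l by (auto simp: ckr_partition_def)
  have "j = 0"
  proof (rule ccontr)
    assume "j \<noteq> 0"
    then obtain i where i: "j = Suc i" by (cases j) auto
    obtain p where p: "h l = Suc p" using \<open>h l > 0\<close> by (cases "h l") auto
    have "T x \<in> preimage_iter (topspace X) T i (B k)"
      "T x \<in> preimage_iter (topspace X) T p (B l)"
      using kj(3) x T by (auto simp: preimage_iter_def i p funpow_swap1)
    then have "k = l \<and> i = p"
      using ckr_partition_unique[OF part, of k i l p "T x"] kj i p l by auto
    then show False using kj(2) i p by auto
  qed
  then show "x \<in> kr_base c B"
    using kj by (auto simp: preimage_iter_def kr_base_def)
qed

text \<open>
  The visits of the tower over \<open>B' l\<close> to the towers \<open>k\<close> occupy disjoint time intervals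
  \<open>[j k, j k + h k)\<close>; none of them passes time \<open>h' l\<close>, when the orbit is back in the base.
\<close>

lemma ckr_partition_sum_heights_le:
  assumes T: "T ` topspace X = topspace X"
    and part: "ckr_partition X T c h B" and part': "ckr_partition X T c' h' B'"
    and base: "kr_base c' B' \<subseteq> kr_base c B"
    and l: "l \<in> {1..c'}"
    and visit: "\<forall>k\<in>{1..c}. \<exists>j<h' l. preimage_iter (topspace X) T j (B' l) \<subseteq> B k"
  shows "(\<Sum>k\<in>{1..c}. h k) \<le> h' l"
proof -
  let ?S = "topspace X"
  have TS: "T ` ?S \<subseteq> ?S" using T by simp
  obtain j where j: "\<And>k. k \<in> {1..c} \<Longrightarrow> j k < h' l"
    "\<And>k. k \<in> {1..c} \<Longrightarrow> preimage_iter ?S T (j k) (B' l) \<subseteq> B k"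
    using visit by metis
  \<comment> \<open>Iterates of \<open>T\<close> are surjective, so a point of \<open>B' l\<close>
    can be pulled back any number of steps, in particular \<open>h' l\<close> steps, one past the
    top floor.\<close>
  have ex: "\<exists>x\<in>?S. (T ^^ i) x \<in> B' l" for i
  proof -
    obtain b where "b \<in> B' l" using part' l unfolding ckr_partition_def by blast
    moreover have "b \<in> ?S" using calculation ckr_partition_base_subset[OF part' l] by auto
    ultimately show ?thesis using funpow_image_eq[OF T, of i] by (metis imageE)
  qed
  \<comment> \<open>After \<open>p - j k\<close> steps \<open>x\<close> is \<open>j k\<close> steps
    away from \<open>B' l\<close>, hence in \<open>B k\<close>. Nothing bounds
    \<open>p - j k\<close> here; it is a floor number only when below \<open>h k\<close>.\<close>
  have floor: "x \<in> preimage_iter ?S T (p - j k) (B k)"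
    if "k \<in> {1..c}" "j k \<le> p" "x \<in> ?S" "(T ^^ p) x \<in> B' l" for p k x
  proof -
    have "(T ^^ j k) ((T ^^ (p - j k)) x) = (T ^^ p) x"
      using that(2) by (metis comp_apply funpow_add le_add_diff_inverse)
    then have "(T ^^ (p - j k)) x \<in> preimage_iter ?S T (j k) (B' l)"
      using that funpow_in[OF TS] by (simp add: preimage_iter_def)
    then show ?thesis using j(2)[OF that(1)] that(3) by (auto simp: preimage_iter_def)
  qed
  have top: "j k + h k \<le> h' l" if k: "k \<in> {1..c}" for k
  proof (rule ccontr)
    assume less: "\<not> j k + h k \<le> h' l"
    obtain x where x: "x \<in> ?S" "(T ^^ h' l) x \<in> B' l" using ex by blast
    \<comment> \<open>This point is on floor 0 of some tower \<open>k'\<close>, yet the overlong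
      visit would also put it on the positive floor \<open>h' l - j k\<close> of tower
      \<open>k\<close>.\<close>
    have "x \<in> kr_base c' B'"
      using ckr_partition_return[OF part' TS l] x by (auto simp: preimage_iter_def)
    then obtain k' where k': "k' \<in> {1..c}" "x \<in> B k'"
      using base by (auto simp: kr_base_def)
    have "h k' > 0" using part k' by (auto simp: ckr_partition_def)
    moreover have "x \<in> preimage_iter ?S T 0 (B k')" using k' x by (simp add: preimage_iter_def)
    moreover have "x \<in> preimage_iter ?S T (h' l - j k) (B k)"
      using floor[OF k _ x] j(1)[OF k] by simp
    moreover have "h' l - j k < h k" using less j(1)[OF k] by linarith
    ultimately have "h' l - j k = 0"
      using ckr_partition_unique[OF part] k k' by metis
    then show False using j(1)[OF k] by simp
  qed
  have disj: "{j k..<j k + h k} \<inter> {j k'..<j k' + h k'} = {}"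
    if k: "k \<in> {1..c}" "k' \<in> {1..c}" "k \<noteq> k'" for k k'
  proof (rule ccontr)
    assume "{j k..<j k + h k} \<inter> {j k'..<j k' + h k'} \<noteq> {}"
    then obtain p where p: "j k \<le> p" "p < j k + h k" "j k' \<le> p" "p < j k' + h k'"
      unfolding disjoint_iff atLeastLessThan_iff by blast
    obtain x where x: "x \<in> ?S" "(T ^^ p) x \<in> B' l" using ex by blast
    have "p - j k < h k" "p - j k' < h k'" using p by linarith+
    then have "k = k'"
      using ckr_partition_unique[OF part k(1) _ k(2)]
        floor[OF k(1) p(1) x] floor[OF k(2) p(3) x] by metis
    then show False using k by simp
  qed
  have "(\<Sum>k\<in>{1..c}. h k) = card (\<Union>k\<in>{1..c}. {j k..<j k + h k})"
    using disj by (subst card_UN_disjoint) auto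
  also have "\<dots> \<le> card {..<h' l}"
    using top by (intro card_mono) fastforce+
  finally show ?thesis by simp
qed

text \<open>
  If the heights stayed bounded along infinitely many levels, every point would reach the
  unique point of \<open>\<Inter>n. B(n)\<close> within a bounded time, and the space would be finite.
\<close>

lemma eventually_heights_gt:
  assumes inj: "inj_on T (topspace X)" and inf: "infinite (topspace X)"
    and T: "T ` topspace X = topspace X"
    and part: "\<And>n. ckr_partition X T (C n) (h n) (B n)"
    and KR1: "KR1 C B" and KR3: "KR3 C B" and LR: "LR L C h" and "L > 0"
  shows "\<forall>\<^sub>F n in sequentially. \<forall>k\<in>{1..C n}. h n k > K"
proof (rule ccontr)
  let ?S = "topspace X" and ?b = "\<lambda>n. kr_base (C n) (B n)"
  \<comment> \<open>By \<open>LR\<close>, a single tower of height at most \<open>K\<close> at level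
    \<open>n\<close> forces all heights at level \<open>n + 1\<close> to be at most
    \<open>K'\<close>.\<close>
  define K' where "K' = nat \<lceil>L * K\<rceil>"
  assume "\<not> (\<forall>\<^sub>F n in sequentially. \<forall>k\<in>{1..C n}. h n k > K)"
  then have freq: "\<exists>\<^sub>F n in sequentially. \<exists>k\<in>{1..C n}. h n k \<le> K"
    by (simp add: frequently_def not_less not_le)
  have anti: "antimono ?b"
    using KR1 by (auto simp: KR1_def antimono_iff_le_Suc)
  obtain z where z: "(\<Inter>n. ?b n) = {z}" using KR3 by (auto simp: KR3_def is_singleton_def)
  have cover: "?S \<subseteq> (\<Union>j<K'. {y \<in> ?S. (T ^^ j) y = z})"
  proof (rule ccontr)
    assume "\<not> ?thesis"
    then obtain y where y: "y \<in> ?S" "\<And>j. j < K' \<Longrightarrow> (T ^^ j) y \<noteq> z" by auto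
    \<comment> \<open>The bases decrease to \<open>{z}\<close>, so each of the finitely many points
      \<open>(T ^^ j) y\<close> is outside them from some level on.\<close>
    have "\<forall>\<^sub>F n in sequentially. (T ^^ j) y \<notin> ?b n" if j: "j < K'" for j
    proof -
      obtain n where "(T ^^ j) y \<notin> ?b n" using y(2)[OF j] z by blast
      then show ?thesis
        using anti by (auto simp: eventually_sequentially antimono_def)
    qed
    then have "\<forall>\<^sub>F n in sequentially. \<forall>j\<in>{..<K'}. (T ^^ j) y \<notin> ?b n"
      by (intro eventually_ball_finite) auto
    then have "\<forall>\<^sub>F n in sequentially. \<forall>j\<in>{..<K'}. (T ^^ j) y \<notin> ?b (Suc n)"
      by (subst eventually_sequentially_Suc)
    then obtain n k where n: "\<forall>j<K'. (T ^^ j) y \<notin> ?b (Suc n)" and k: "k \<in> {1..C n}" "h n k \<le> K"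
      using frequently_eventually_frequently[OF freq] frequently_ex by fastforce
    obtain l j where lj: "l \<in> {1..C (Suc n)}" "j < h (Suc n) l"
        "y \<in> preimage_iter ?S T j (B (Suc n) l)"
      using ckr_partition_cover[OF part y(1)] .
    have "real (h (Suc n) l) \<le> L * real (h n k)"
      using LR lj(1) k(1) by (force simp: LR_def)
    also have "\<dots> \<le> L * K" using k \<open>L > 0\<close> by simp
    finally have "h (Suc n) l \<le> K'" unfolding K'_def by linarith
    then show False
      using n lj by (auto simp: preimage_iter_def kr_base_def)
  qed
  \<comment> \<open>By injectivity each of the \<open>K'\<close> fibres in the cover has at most one
    point.\<close>
  have "inj_on (T ^^ j) ?S" for j
  proof (induction j)
    case (Suc j)
    then show ?case
      using inj funpow_image_eq[OF T, of j] comp_inj_on[of "T ^^ j" ?S T] by (simp add: comp_def)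
  qed simp
  then have "finite {y \<in> ?S. (T ^^ j) y = z}" for j
    using finite_inverse_image_gen[of "{z}" "T ^^ j" ?S] by (simp add: conj_commute)
  then have "finite (\<Union>j<K'. {y \<in> ?S. (T ^^ j) y = z})" by auto
  then show False using cover inf finite_subset by blast
qed

section \<open>Sums of squares, nested atoms and invariant measures\<close>

lemma sum_squares_less:
  fixes p :: "'i \<Rightarrow> real"
  assumes "finite I" "sum p I = 1" and p: "\<And>i. i \<in> I \<Longrightarrow> 0 \<le> p i" "\<And>i. i \<in> I \<Longrightarrow> p i < c"
  shows "(\<Sum>i\<in>I. p i * p i) < c"
proof -
  \<comment> \<open>An index of nonzero weight is what makes the comparison with the sum of
    \<open>c * p i\<close> strict.\<close>
  obtain i where i: "i \<in> I" "p i \<noteq> 0"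
    using assms(2) by (metis sum.neutral zero_neq_one)
  have "(\<Sum>i\<in>I. p i * p i) < (\<Sum>i\<in>I. c * p i)"
  proof (rule sum_strict_mono_ex1[OF \<open>finite I\<close>])
    show "\<forall>i\<in>I. p i * p i \<le> c * p i"
      using p by (simp add: mult_right_mono less_imp_le)
    show "\<exists>i\<in>I. p i * p i < c * p i"
      using i p[OF i(1)] by (intro bexI[of _ i] mult_strict_right_mono) auto
  qed
  also have "\<dots> = c" using assms(2) by (simp add: sum_distrib_left[symmetric])
  finally show ?thesis .
qed

lemma ckr_atom_nested:
  assumes KR2: "KR2 X T C h B" and "m \<le> n" and "P \<in> kr_atoms X T (C n) (h n) (B n)"
  shows "\<exists>Q\<in>kr_atoms X T (C m) (h m) (B m). P \<subseteq> Q"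
  using \<open>m \<le> n\<close> \<open>P \<in> _\<close>
proof (induction n arbitrary: P rule: dec_induct)
  case (step n)
  then show ?case using KR2 unfolding KR2_def by (meson order_trans)
qed auto

text \<open>Continuity gives measurability because the open sets generate \<open>sets M\<close>;
  invariance under \<open>T\<close> then passes to its iterates by induction.\<close>

lemma invariant_borel_prob_preimage_iter:
  assumes M: "invariant_borel_prob X T M" and cont: "continuous_map X X T" and A: "A \<in> sets M"
  shows "preimage_iter (topspace X) T n A \<in> sets M \<and>
    measure M (preimage_iter (topspace X) T n A) = measure M A"
proof (induction n)
  case 0
  have "A \<subseteq> topspace X"
    using M sets.sets_into_space[OF A] by (simp add: invariant_borel_prob_def)
  then show ?case using A by (simp add: preimage_iter_def inf.absorb1)
next
  case (Suc n)
  have TS: "T ` topspace X \<subseteq> topspace X" using cont by (simp add: continuous_map_image_subset_topspace)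
  have sp: "space M = topspace X" and sts: "sets M = sigma_sets (topspace X) {U. openin X U}"
    using M by (auto simp: invariant_borel_prob_def)
  have "T \<in> measurable M M"
  proof (rule measurable_sigma_sets[OF sts])
    show "{U. openin X U} \<subseteq> Pow (topspace X)" using openin_subset by auto
    show "T \<in> space M \<rightarrow> topspace X" using TS sp by auto
    fix U assume "U \<in> {U. openin X U}"
    then have "openin X {x \<in> topspace X. T x \<in> U}"
      using cont by (simp add: openin_continuous_map_preimage)
    moreover have "T -` U \<inter> space M = {x \<in> topspace X. T x \<in> U}" using sp by auto
    ultimately show "T -` U \<inter> space M \<in> sets M" using sts by auto
  qed
  then have "preimage_iter (topspace X) T 1 (preimage_iter (topspace X) T n A) \<in> sets M"
    using Suc measurable_sets[of T M M] sp by (simp add: preimage_iter_def[of _ T "Suc 0"])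
  moreover have "measure M (preimage_iter (topspace X) T 1 (preimage_iter (topspace X) T n A))
      = measure M (preimage_iter (topspace X) T n A)"
    using M Suc sp by (simp add: invariant_borel_prob_def measure_def)
  ultimately show ?case
    using Suc by (simp add: preimage_iter_preimage_iter[OF TS])
qed

theorem proposition6:
  fixes X :: "'a topology" and T :: "'a \<Rightarrow> 'a" and \<mu> :: "'a measure"
  assumes "linearly_recurrent X T"
    and "invariant_borel_prob X T \<mu>"
  shows "\<not> strongly_mixing \<mu> T"
proof
  assume mix: "strongly_mixing \<mu> T"
  let ?S = "topspace X"
  obtain C h B L where seq: "ckr_sequence X T C h B" and KR1: "KR1 C B" and KR2: "KR2 X T C h B"
    and KR3: "KR3 C B" and KR5: "KR5 X T C h B" and KR6: "KR6 C B" and LR: "LR L C h"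
    using assms(1) unfolding linearly_recurrent_def by blast
  have cantor: "cantor_space X" and homeo: "homeomorphic_map X X T"
    using assms(1) by (auto simp: linearly_recurrent_def minimal_cantor_system_def cantor_system_def)
  have cont: "continuous_map X X T" and inj: "inj_on T ?S" and T: "T ` ?S = ?S"
    using homeo homeomorphic_imp_continuous_map homeomorphic_imp_injective_map
      homeomorphic_imp_surjective_map by blast+
  have TS: "T ` ?S \<subseteq> ?S" using T by simp
  interpret prob_space \<mu> using assms(2) by (simp add: invariant_borel_prob_def)
  have sp: "space \<mu> = ?S" and sts: "sets \<mu> = sigma_sets ?S {U. openin X U}"
    using assms(2) by (auto simp: invariant_borel_prob_def)
  note inv = invariant_borel_prob_preimage_iter[OF assms(2) cont]
  have part: "ckr_partition X T (C n) (h n) (B n)" for n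
    using seq by (simp add: ckr_sequence_def)
  have C: "1 \<le> C n" for n using part[of n] by (simp add: ckr_partition_def)
  have hpos: "h n k > 0" if "k \<in> {1..C n}" for n k
    using part[of n] that by (simp add: ckr_partition_def)
  have Bsets: "B n k \<in> sets \<mu>" if "k \<in> {1..C n}" for n k
    using part[of n] that sts by (auto simp: ckr_partition_def)
  have LR': "real (h (Suc n) l) \<le> L * real (h n k)"
    if "l \<in> {1..C (Suc n)}" "k \<in> {1..C n}" for n k l
    using LR that by (force simp: LR_def)
  \<comment> \<open>Heights are positive, so the recurrence bound between levels 0 and 1 fixes the
    sign of \<open>L\<close>.\<close>
  have "0 < L * real (h 0 1)"
    using LR'[of 1 0 1] hpos[of 1 1] C[of 0] C[of 1] by force
  then have "L > 0" by (simp add: zero_less_mult_iff)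

  \<comment> \<open>The number of towers and the masses of atoms\<close>
  have CL: "real (C n) \<le> L" for n
  proof -
    \<comment> \<open>For the shortest tower \<open>k\<close> one gets
      \<open>C n * h n k \<le> h (Suc n) 1 \<le> L * h n k\<close>, and \<open>h n k\<close>
      cancels.\<close>
    define k where "k = (ARG_MIN (h n) k. k \<in> {1..C n})"
    have k: "k \<in> {1..C n}" "\<And>i. i \<in> {1..C n} \<Longrightarrow> h n k \<le> h n i"
      unfolding k_def using C[of n]
      by (metis arg_min_nat_lemma atLeastAtMost_iff order_refl)+
    have one: "1 \<in> {1..C (Suc n)}" using C by simp
    have "C n * h n k \<le> (\<Sum>i\<in>{1..C n}. h n i)"
      using sum_bounded_below[of "{1..C n}" "h n k" "h n"] k by simp
    also have "\<dots> \<le> h (Suc n) 1"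
      using KR1 KR5 one
      by (intro ckr_partition_sum_heights_le[OF T part part]) (force simp: KR1_def KR5_def)+
    finally have "real (C n * h n k) \<le> L * real (h n k)"
      using LR'[OF one k(1)] by linarith
    then show ?thesis using hpos[OF k(1)] by simp
  qed
  let ?I = "\<lambda>n. kr_index (C n) (h n)" and ?A = "\<lambda>n. kr_atom ?S T (B n)"
  have Asets: "?A n i \<in> sets \<mu>" if "i \<in> ?I n" for n i
    using that inv Bsets by (auto split: prod.splits)
  have mA: "measure \<mu> (preimage_iter ?S T j (B n k)) = measure \<mu> (B n k)"
    if "k \<in> {1..C n}" for n j k
    using that inv Bsets by auto
  have disj: "disjoint_family_on (?A n) (?I n)" for n
    using part[of n] by (simp add: ckr_partition_def)
  have total: "(\<Sum>i\<in>?I n. measure \<mu> (?A n i)) = 1" for n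
  proof -
    have "(\<Union>i\<in>?I n. ?A n i) = space \<mu>"
      using part[of n] sp by (simp add: ckr_partition_def kr_atoms_def)
    then show ?thesis
      using finite_measure_finite_Union[OF _ _ disj[of n]] Asets prob_space
      by (metis (no_types, lifting) finite_kr_index image_subsetI)
  qed
  have towers: "(\<Sum>k\<in>{1..C n}. real (h n k) * measure \<mu> (B n k)) = 1" for n
  proof -
    have "(\<Sum>i\<in>?I n. measure \<mu> (?A n i))
        = (\<Sum>k\<in>{1..C n}. \<Sum>j<h n k. measure \<mu> (preimage_iter ?S T j (B n k)))"
      unfolding kr_index_def by (subst sum.Sigma) (auto intro!: sum.cong)
    then show ?thesis using total[of n] mA by simp
  qed
  have heights: "\<forall>\<^sub>F n in sequentially. \<forall>k\<in>{1..C n}. h n k > K" for K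
    by (rule eventually_heights_gt[OF inj cantor_space_infinite[OF cantor] T part KR1 KR3 LR \<open>L > 0\<close>])

  \<comment> \<open>The limit forced by mixing\<close>
  obtain m where m: "\<And>k. k \<in> {1..C m} \<Longrightarrow> h m k > nat \<lceil>L\<^sup>2\<rceil>"
    using heights[of "nat \<lceil>L\<^sup>2\<rceil>"] unfolding eventually_sequentially by blast
  \<comment> \<open>A tower has mass at most 1, shared equally by its more than
    \<open>L\<^sup>2\<close> floors.\<close>
  have small: "measure \<mu> (?A m i) < 1 / L\<^sup>2" if "i \<in> ?I m" for i
  proof -
    obtain k j where i: "i = (k, j)" "k \<in> {1..C m}" using \<open>i \<in> ?I m\<close> by (cases i) auto
    have "real (h m k) * measure \<mu> (B m k) \<le> 1"
      using member_le_sum[of k "{1..C m}" "\<lambda>k. real (h m k) * measure \<mu> (B m k)"] towers[of m] i by simp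
    moreover have "L\<^sup>2 < real (h m k)" using m[OF i(2)] by linarith
    ultimately have "measure \<mu> (B m k) \<le> 1 / real (h m k)" "1 / real (h m k) < 1 / L\<^sup>2"
      using \<open>L > 0\<close> hpos[OF i(2)] by (auto simp: field_simps intro!: divide_strict_left_mono)
    then show ?thesis using mA i by simp
  qed
  have "(\<Sum>i\<in>?I m. measure \<mu> (?A m i) * measure \<mu> (?A m i)) < 1 / L\<^sup>2"
    by (rule sum_squares_less) (use total small in auto)
  moreover have "(\<lambda>t. \<Sum>i\<in>?I m. measure \<mu> (?A m i \<inter> preimage_iter ?S T t (?A m i)))
      \<longlonglongrightarrow> (\<Sum>i\<in>?I m. measure \<mu> (?A m i) * measure \<mu> (?A m i))"
  proof (rule tendsto_sum)
    fix i assume "i \<in> ?I m"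
    then show "(\<lambda>t. measure \<mu> (?A m i \<inter> preimage_iter ?S T t (?A m i)))
        \<longlonglongrightarrow> measure \<mu> (?A m i) * measure \<mu> (?A m i)"
      using mix Asets unfolding strongly_mixing_def sp by metis
  qed
  ultimately have "\<forall>\<^sub>F t in sequentially.
      (\<Sum>i\<in>?I m. measure \<mu> (?A m i \<inter> preimage_iter ?S T t (?A m i))) < 1 / L\<^sup>2"
    by (rule order_tendstoD(2)[rotated])
  then obtain t0 where t0: "\<And>t. t \<ge> t0 \<Longrightarrow>
      (\<Sum>i\<in>?I m. measure \<mu> (?A m i \<inter> preimage_iter ?S T t (?A m i))) < 1 / L\<^sup>2"
    by (auto simp: eventually_sequentially)

  \<comment> \<open>Returns of a heavy tower at a high level\<close>
  obtain n where n: "m \<le> n" "\<And>k. k \<in> {1..C (Suc n)} \<Longrightarrow> h (Suc n) k > t0"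
    using heights[of t0] unfolding eventually_sequentially
    by (metis le_SucI max.cobounded1 max.cobounded2)
  \<comment> \<open>Pigeonhole: at most \<open>L\<close> towers share the total mass 1.\<close>
  obtain l where l: "l \<in> {1..C (Suc n)}" "real (h (Suc n) l) * measure \<mu> (B (Suc n) l) \<ge> 1 / L"
  proof -
    have "\<exists>l\<in>{1..C (Suc n)}. real (h (Suc n) l) * measure \<mu> (B (Suc n) l) \<ge> 1 / L"
    proof (rule ccontr)
      assume "\<not> ?thesis"
      then have "(\<Sum>l\<in>{1..C (Suc n)}. real (h (Suc n) l) * measure \<mu> (B (Suc n) l))
          < (\<Sum>l\<in>{1..C (Suc n)}. 1 / L)"
        using C[of "Suc n"] by (intro sum_strict_mono) (auto simp: not_le)
      also have "\<dots> \<le> 1" using CL[of "Suc n"] \<open>L > 0\<close> by simp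
      finally show False using towers[of "Suc n"] by simp
    qed
    then show ?thesis using that by blast
  qed
  define t where "t = h (Suc n) l"
  \<comment> \<open>\<open>E j\<close> is the preimage under \<open>T ^^ t\<close> of floor
    \<open>j\<close> over \<open>B (Suc n) l\<close>. For \<open>j < h n 1\<close>, its points and
    their images under \<open>T ^^ t\<close> all lie on floor \<open>j\<close> of the first tower of
    level \<open>n\<close>.\<close>
  define E where "E j = preimage_iter ?S T (j + t) (B (Suc n) l)" for j
  have one: "1 \<in> {1..C n}" using C by simp
  have baseB: "kr_base (C (Suc n)) (B (Suc n)) \<subseteq> B n 1"
    using KR6 by (simp add: KR6_def)
  \<comment> \<open>Since \<open>t\<close> is the full height of tower \<open>l\<close>, going back
    \<open>t\<close> steps from its base ends in the base of level \<open>n + 1\<close>, which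
    \<open>KR6\<close> puts into \<open>B n 1\<close>.\<close>
  have E1: "E j \<subseteq> preimage_iter ?S T j (B n 1)" for j
  proof -
    have "E j = preimage_iter ?S T j (preimage_iter ?S T t (B (Suc n) l))"
      by (simp add: E_def preimage_iter_preimage_iter[OF TS] add.commute)
    also have "\<dots> \<subseteq> preimage_iter ?S T j (B n 1)"
      using ckr_partition_return[OF part TS l(1)] baseB unfolding t_def
      by (intro preimage_iter_mono) blast
    finally show ?thesis .
  qed
  have E2: "E j \<subseteq> preimage_iter ?S T t (preimage_iter ?S T j (B n 1))" for j
  proof -
    have "B (Suc n) l \<subseteq> B n 1" using baseB l(1) unfolding kr_base_def by blast
    then show ?thesis
      unfolding E_def preimage_iter_preimage_iter[OF TS] by (rule preimage_iter_mono)
  qed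
  \<comment> \<open>One atom of level \<open>m\<close> contains the whole floor \<open>j\<close> of
    level \<open>n\<close>, hence both positions at once; nesting applies because
    \<open>m \<le> n\<close>.\<close>
  have Esub: "\<exists>i\<in>?I m. E j \<subseteq> ?A m i \<inter> preimage_iter ?S T t (?A m i)" if "j < h n 1" for j
  proof -
    have "preimage_iter ?S T j (B n 1) \<in> kr_atoms X T (C n) (h n) (B n)"
      using one that by (force simp: kr_atoms_def)
    then obtain Q where Q: "Q \<in> kr_atoms X T (C m) (h m) (B m)" "preimage_iter ?S T j (B n 1) \<subseteq> Q"
      using ckr_atom_nested[OF KR2 n(1)] by blast
    have "E j \<subseteq> Q \<inter> preimage_iter ?S T t Q"
      using E1[of j] E2[of j] Q(2) preimage_iter_mono[OF Q(2), of ?S T t] by blast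
    moreover obtain i where "i \<in> ?I m" "Q = ?A m i"
      using Q(1) unfolding kr_atoms_def by (rule imageE)
    ultimately show ?thesis by metis
  qed
  have Esets: "E j \<in> sets \<mu>" and mE: "measure \<mu> (E j) = measure \<mu> (B (Suc n) l)" for j
    using inv Bsets[OF l(1)] by (auto simp: E_def)
  have Edisj: "disjoint_family_on E {..<h n 1}"
    unfolding disjoint_family_on_def using ckr_partition_unique[OF part one _ one] E1 by blast
  have Isets: "?A m i \<inter> preimage_iter ?S T t (?A m i) \<in> sets \<mu>" if "i \<in> ?I m" for i
    using Asets[OF that] inv by blast

  \<comment> \<open>The lower bound contradicting the limit\<close>
  have "1 / L\<^sup>2 = 1 / L / L" by (simp add: power2_eq_square)
  also have "\<dots> \<le> real (h (Suc n) l) * measure \<mu> (B (Suc n) l) / L"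
    using l(2) \<open>L > 0\<close> by (intro divide_right_mono) auto
  \<comment> \<open>Linear recurrence trades the height of tower \<open>l\<close> for
    \<open>h n 1\<close>, the number of sets \<open>E j\<close>.\<close>
  also have "\<dots> \<le> L * real (h n 1) * measure \<mu> (B (Suc n) l) / L"
    using LR'[OF l(1) one] \<open>L > 0\<close> by (intro divide_right_mono mult_right_mono) auto
  also have "\<dots> = (\<Sum>j<h n 1. measure \<mu> (E j))"
    using \<open>L > 0\<close> mE by simp
  also have "\<dots> = measure \<mu> (\<Union>j<h n 1. E j)"
    using Esets Edisj by (intro finite_measure_finite_Union[symmetric]) auto
  \<comment> \<open>Several \<open>E j\<close> may fall into the same atom, so unions are compared
    before passing to the sum over \<open>i\<close>.\<close>
  also have "\<dots> \<le> measure \<mu> (\<Union>i\<in>?I m. ?A m i \<inter> preimage_iter ?S T t (?A m i))"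
    using Esub Isets by (intro finite_measure_mono sets.finite_UN) fastforce+
  also have "\<dots> \<le> (\<Sum>i\<in>?I m. measure \<mu> (?A m i \<inter> preimage_iter ?S T t (?A m i)))"
    using Isets by (intro finite_measure_subadditive_finite) auto
  also have "\<dots> < 1 / L\<^sup>2"
    using t0[of t] n(2)[OF l(1)] by (simp add: t_def)
  finally show False by simp
qed

end
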